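(* Write $\Theta_n=\{\phi_1,\dots,\phi_s\}$ and let $I\subseteq\{1,\dots,s\}$. The rule $r=\frac{\bigvee_{i\in I}\phi_i}{p_1}$ is inadmissible in $S4$ iff there is a set $W\subseteq\{\phi_i\mid i\in I\}$ such that (1) there is $\phi_j\in W$ with $\mathcal M(\Theta_n,W),\phi_j\not\models p_1$; (2) $\mathcal M(\Theta_n,W),\phi_j\models\phi_j$ for all $\phi_j\in W$; (3) for each subset $D$ of $W$ (including $D=\emptyset$) there exists $\phi_j\in W$ such that $\theta_\diamond(\phi_j)=\theta(\phi_j)\cup\bigcup_{\phi\in D}\theta_\diamond(\phi)$.
   Context: $S4$ is the normal modal logic with axioms $K$, $T:\Box A\to A$, $4:\Box A\to\Box\Box A$ and necessitation; $\diamond=\neg\Box\neg$. A substitution $\sigma$ rejects a rule $\frac{\alpha}{\beta}$ if $\vdash_{S4}\sigma(\alpha)$ and $\nvdash_{S4}\sigma(\beta)$; the rule is admissible if no substitution rejects it, inadmissible otherwise. Fix variables $p_1,\dots,p_n$; $\alpha^1=\alpha$, $\alpha^0=\neg\alpha$. $\Theta_n$ is the set of all disjuncts $\bigwedge_{i=1}^n p_i^{t(i,0)}\wedge\bigwedge_{i=1}^n(\diamond p_i)^{t(i,1)}$, $t:\{1,\dots,n\}\times\{0,1\}\to\{0,1\}$. For such $\phi$, $\theta(\phi)=\{p_i\mid t(i,0)=1\}$, $\theta_\diamond(\phi)=\{p_i\mid t(i,1)=1\}$. For $W\subseteq\Theta_n$, $\mathcal M(\Theta_n,W)$ is the Kripke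 model with worlds $W$, $\phi R\psi$ iff $\theta_\diamond(\psi)\subseteq\theta_\diamond(\phi)$, and $p_i$ true at $\phi$ iff $p_i\in\theta(\phi)$. *)

theory Defs
  imports Main
begin

section \<open>Modal formulas and the logic S4\<close>

text \<open>The propositional variables are the natural numbers; the variable $p_i$ is \<open>i\<close>, and
  as a formula it is \<open>Var i\<close>. Substitutions may use variables other than $p_1, \dots, p_n$.\<close>

datatype fm =
    Var nat
  | Bot
  | Neg fm
  | And fm fm
  | Or fm fm
  | Imp fm fm
  | Box fm

definition Dia :: "fm \<Rightarrow> fm" where
  "Dia A = Neg (Box (Neg A))"

text \<open>Boolean evaluation, with boxed formulas treated as additional atoms.\<close>

primrec beval :: "(nat \<Rightarrow> bool) \<Rightarrow> (fm \<Rightarrow> bool) \<Rightarrow> fm \<Rightarrow> bool" where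
  "beval v b (Var i) = v i"
| "beval v b Bot = False"
| "beval v b (Neg A) = (\<not> beval v b A)"
| "beval v b (And A B) = (beval v b A \<and> beval v b B)"
| "beval v b (Or A B) = (beval v b A \<or> beval v b B)"
| "beval v b (Imp A B) = (beval v b A \<longrightarrow> beval v b B)"
| "beval v b (Box A) = b A"

definition tautology :: "fm \<Rightarrow> bool" where
  "tautology A \<longleftrightarrow> (\<forall>v b. beval v b A)"

inductive S4 :: "fm \<Rightarrow> bool" where
  taut: "tautology A \<Longrightarrow> S4 A"
| ax_K: "S4 (Imp (Box (Imp A B)) (Imp (Box A) (Box B)))"
| ax_T: "S4 (Imp (Box A) A)"
| ax_4: "S4 (Imp (Box A) (Box (Box A)))"
| mp: "S4 (Imp A B) \<Longrightarrow> S4 A \<Longrightarrow> S4 B"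
| nec: "S4 A \<Longrightarrow> S4 (Box A)"

section \<open>Substitutions and admissibility\<close>

primrec subst :: "(nat \<Rightarrow> fm) \<Rightarrow> fm \<Rightarrow> fm" where
  "subst \<sigma> (Var i) = \<sigma> i"
| "subst \<sigma> Bot = Bot"
| "subst \<sigma> (Neg A) = Neg (subst \<sigma> A)"
| "subst \<sigma> (And A B) = And (subst \<sigma> A) (subst \<sigma> B)"
| "subst \<sigma> (Or A B) = Or (subst \<sigma> A) (subst \<sigma> B)"
| "subst \<sigma> (Imp A B) = Imp (subst \<sigma> A) (subst \<sigma> B)"
| "subst \<sigma> (Box A) = Box (subst \<sigma> A)"

text \<open>A rule is a pair of its premise and its conclusion.\<close>

type_synonym rule = "fm \<times> fm"

definition rejects :: "(nat \<Rightarrow> fm) \<Rightarrow> rule \<Rightarrow> bool" where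
  "rejects \<sigma> r \<longleftrightarrow> S4 (subst \<sigma> (fst r)) \<and> \<not> S4 (subst \<sigma> (snd r))"

definition admissible :: "rule \<Rightarrow> bool" where
  "admissible r \<longleftrightarrow> \<not> (\<exists>\<sigma>. rejects \<sigma> r)"

section \<open>Kripke models\<close>

record 'w kripke =
  worlds :: "'w set"
  acc :: "'w \<Rightarrow> 'w \<Rightarrow> bool"
  val :: "'w \<Rightarrow> nat \<Rightarrow> bool"

primrec sat :: "'w kripke \<Rightarrow> 'w \<Rightarrow> fm \<Rightarrow> bool" where
  "sat M w (Var i) = val M w i"
| "sat M w Bot = False"
| "sat M w (Neg A) = (\<not> sat M w A)"
| "sat M w (And A B) = (sat M w A \<and> sat M w B)"
| "sat M w (Or A B) = (sat M w A \<or> sat M w B)"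
| "sat M w (Imp A B) = (sat M w A \<longrightarrow> sat M w B)"
| "sat M w (Box A) = (\<forall>u\<in>worlds M. acc M w u \<longrightarrow> sat M u A)"

section \<open>The disjuncts\<close>

fun Conj :: "fm list \<Rightarrow> fm" where
  "Conj [] = Neg Bot"
| "Conj [A] = A"
| "Conj (A # B # As) = And A (Conj (B # As))"

fun Disj :: "fm list \<Rightarrow> fm" where
  "Disj [] = Bot"
| "Disj [A] = A"
| "Disj (A # B # As) = Or A (Disj (B # As))"

text \<open>$\bigvee_{i \in I} \varphi_i$, for finite \<open>I\<close>, in increasing order of the indices.\<close>

definition BigDisj :: "(nat \<Rightarrow> fm) \<Rightarrow> nat set \<Rightarrow> fm" where
  "BigDisj \<phi> I = Disj (map \<phi> (sorted_list_of_set I))"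

text \<open>The notation $\alpha^1 = \alpha$, $\alpha^0 = \neg\alpha$, with truth values for exponents.\<close>

definition lit :: "fm \<Rightarrow> bool \<Rightarrow> fm" where
  "lit A b = (if b then A else Neg A)"

text \<open>Only the values of \<open>t i k\<close> with \<open>i \<in> {1..n}\<close> and \<open>k \<in> {0, 1}\<close> matter.\<close>

definition disjunct :: "nat \<Rightarrow> (nat \<Rightarrow> nat \<Rightarrow> bool) \<Rightarrow> fm" where
  "disjunct n t =
     And (Conj (map (\<lambda>i. lit (Var i) (t i 0)) [1..<Suc n]))
         (Conj (map (\<lambda>i. lit (Dia (Var i)) (t i 1)) [1..<Suc n]))"

definition Theta :: "nat \<Rightarrow> fm set" where
  "Theta n = range (disjunct n)"

text \<open>The map \<open>t\<close> is recovered from the formula; by the lemmas \<open>theta_disjunct\<close> and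
  \<open>theta_dia_disjunct\<close> below the result does not depend on the choice of \<open>t\<close>.\<close>

definition theta :: "nat \<Rightarrow> fm \<Rightarrow> nat set" where
  "theta n \<phi> = {i \<in> {1..n}. \<exists>t. \<phi> = disjunct n t \<and> t i 0}"

definition theta_dia :: "nat \<Rightarrow> fm \<Rightarrow> nat set" where
  "theta_dia n \<phi> = {i \<in> {1..n}. \<exists>t. \<phi> = disjunct n t \<and> t i 1}"

definition MTheta :: "nat \<Rightarrow> fm set \<Rightarrow> fm kripke" where
  "MTheta n W =
     \<lparr>worlds = W,
      acc = (\<lambda>\<phi> \<psi>. theta_dia n \<psi> \<subseteq> theta_dia n \<phi>),
      val = (\<lambda>\<phi> i. i \<in> theta n \<phi>)\<rparr>"

lemma Conj_inject:
  "length As = length Bs \<Longrightarrow> Conj As = Conj Bs \<Longrightarrow> As = Bs"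
proof (induction As arbitrary: Bs rule: Conj.induct)
  case 1
  then show ?case by simp
next
  case (2 A)
  then show ?case by (cases Bs) auto
next
  case (3 A A' As)
  then obtain B B' Bs' where Bs: "Bs = B # B' # Bs'"
    by (metis length_Suc_conv)
  have "A = B" "Conj (A' # As) = Conj (B' # Bs')"
    using 3(3) by (simp_all add: Bs)
  moreover have "length (A' # As) = length (B' # Bs')"
    using 3(2) by (simp add: Bs)
  ultimately show ?case using 3(1)[of "B' # Bs'"] by (simp add: Bs)
qed

lemma lit_inject: "lit A a = lit A b \<longleftrightarrow> a = b"
proof -
  have "A \<noteq> Neg A"
    by (induction A) auto
  then show ?thesis
    by (auto simp: lit_def split: if_splits)
qed

lemma disjunct_eqD:
  assumes "disjunct n t = disjunct n u" "i \<in> {1..n}"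
  shows "t i 0 = u i 0" "t i 1 = u i 1"
proof -
  have *: "map (\<lambda>i. lit (Var i) (t i 0)) [1..<Suc n] = map (\<lambda>i. lit (Var i) (u i 0)) [1..<Suc n]"
    "map (\<lambda>i. lit (Dia (Var i)) (t i 1)) [1..<Suc n] = map (\<lambda>i. lit (Dia (Var i)) (u i 1)) [1..<Suc n]"
    using assms(1) by (auto simp only: disjunct_def fm.inject intro!: Conj_inject length_map[THEN trans])
      (simp_all only: length_map)
  from assms(2) have "i \<in> set [1..<Suc n]" by auto
  with * show "t i 0 = u i 0" "t i 1 = u i 1"
    by (simp_all only: map_eq_conv lit_inject)
qed

lemma theta_disjunct: "theta n (disjunct n t) = {i \<in> {1..n}. t i 0}"
  unfolding theta_def using disjunct_eqD(1) by blast

lemma theta_dia_disjunct: "theta_dia n (disjunct n t) = {i \<in> {1..n}. t i 1}"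
  unfolding theta_dia_def using disjunct_eqD(2) by blast

end

theory Submission
  imports Defs
begin

text \<open>If \<open>\<sigma>\<close> rejects the rule, take for \<open>W\<close> the disjuncts whose \<open>\<sigma>\<close>-instances are satisfiable; (3)
  is seen by adding a new root below the worlds of the canonical model that realize \<open>D\<close>.

  Conversely, let \<open>\<alpha>\<close> be the disjunction of \<open>W\<close> and choose for each \<open>D \<subseteq> W\<close> a disjunct \<open>d D\<close> as in
  (3). The substitution \<open>repair\<close> keeps the variables wherever \<open>\<box>\<alpha>\<close> holds; elsewhere it gives them the
  values prescribed by \<open>d D\<close>, where \<open>D\<close> consists of the \<open>\<psi> \<in> W\<close> with \<open>\<diamond>(\<box>\<alpha> \<and> \<psi>)\<close>. A world violating
  \<open>\<box>\<alpha>\<close> after one application sees a world that violated it before and has a smaller \<open>D\<close>, while \<open>D\<close>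
  never shrinks under repair. Hence after \<open>k\<close> applications all violating worlds have \<open>card D \<ge> k\<close>, and
  \<open>card W + 1\<close> applications make \<open>\<alpha>\<close> valid in every model. By (2), nothing is changed in the model
  on \<open>W\<close> itself, so \<open>p\<^sub>1\<close> still fails there by (1).\<close>

section \<open>Kripke completeness of S4\<close>

definition preorder_model :: "'w kripke \<Rightarrow> bool" where
  "preorder_model M \<longleftrightarrow>
     (\<forall>w\<in>worlds M. acc M w w) \<and>
     (\<forall>u\<in>worlds M. \<forall>v\<in>worlds M. \<forall>w\<in>worlds M. acc M u v \<longrightarrow> acc M v w \<longrightarrow> acc M u w)"

text \<open>At a fixed world the boxed formulas act as atoms; this gives the soundness of
  tautologies.\<close>

lemma sat_beval: "sat M w A = beval (val M w) (\<lambda>B. sat M w (Box B)) A"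
  by (induction A) auto

lemma sat_Dia: "sat M w (Dia A) \<longleftrightarrow> (\<exists>u\<in>worlds M. acc M w u \<and> sat M u A)"
  by (auto simp: Dia_def)

lemma S4_sound:
  assumes "S4 A" "preorder_model M" "w \<in> worlds M"
  shows "sat M w A"
  using assms(1,3)
proof (induction arbitrary: w)
  case (taut A)
  then show ?case using sat_beval[of M w A] by (simp add: tautology_def)
next
  case (ax_T A)
  then show ?case using assms(2) unfolding preorder_model_def sat.simps by blast
next
  case (ax_4 A)
  then show ?case using assms(2) unfolding preorder_model_def sat.simps by blast
qed simp_all

section \<open>Derivability from assumptions\<close>

abbreviation imps :: "fm list \<Rightarrow> fm \<Rightarrow> fm" where
  "imps xs A \<equiv> foldr Imp xs A"

text \<open>Necessitation applies to theorems only, never to the assumptions in \<open>X\<close>;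
  this makes the deduction theorem hold.\<close>

definition derives :: "fm set \<Rightarrow> fm \<Rightarrow> bool" where
  "derives X A \<longleftrightarrow> (\<exists>xs. set xs \<subseteq> X \<and> S4 (imps xs A))"

lemma beval_imps: "beval v b (imps xs A) \<longleftrightarrow> ((\<forall>x\<in>set xs. beval v b x) \<longrightarrow> beval v b A)"
  by (induction xs) auto

lemma derives_assm: "A \<in> X \<Longrightarrow> derives X A"
  unfolding derives_def
  by (intro exI[of _ "[A]"]) (auto intro!: S4.taut simp: tautology_def)

lemma derives_S4: "S4 A \<Longrightarrow> derives X A"
  unfolding derives_def by (intro exI[of _ "[]"]) auto

text \<open>Carries the propositional reasoning under assumptions: the premise lists are
  concatenated and one tautology does the rest.\<close>

lemma derives_taut2:
  assumes "derives X A" "derives X B" "tautology (Imp A (Imp B C))"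
  shows "derives X C"
proof -
  obtain xs ys where xs: "set xs \<subseteq> X" "S4 (imps xs A)" and ys: "set ys \<subseteq> X" "S4 (imps ys B)"
    using assms unfolding derives_def by blast
  have "tautology (Imp (imps xs A) (Imp (imps ys B) (imps (xs @ ys) C)))"
    using assms(3) unfolding tautology_def beval_imps beval.simps set_append by blast
  then have "S4 (imps (xs @ ys) C)"
    using xs(2) ys(2) S4.taut S4.mp by blast
  then show ?thesis
    using xs(1) ys(1) unfolding derives_def by (intro exI[of _ "xs @ ys"]) auto
qed

lemma derives_taut1: "derives X A \<Longrightarrow> tautology (Imp A C) \<Longrightarrow> derives X C"
  by (rule derives_taut2[of X A A]) (auto simp: tautology_def)

lemma derives_deduction:
  assumes "derives (insert B X) A"
  shows "derives X (Imp B A)"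
proof -
  obtain xs where xs: "set xs \<subseteq> insert B X" "S4 (imps xs A)"
    using assms unfolding derives_def by blast
  let ?ys = "filter (\<lambda>x. x \<noteq> B) xs"
  have "tautology (Imp (imps xs A) (imps ?ys (Imp B A)))"
    unfolding tautology_def beval.simps beval_imps by auto
  then have "S4 (imps ?ys (Imp B A))"
    using xs(2) S4.taut S4.mp by blast
  moreover have "set ?ys \<subseteq> X" using xs(1) by auto
  ultimately show ?thesis unfolding derives_def by blast
qed

text \<open>Axiom K iterated along the list; it turns a derivation of \<open>A\<close> from unboxed
  formulas into one of \<open>Box A\<close> from the boxed ones.\<close>

lemma S4_Box_imps: "S4 (Imp (Box (imps xs A)) (imps (map Box xs) (Box A)))"
proof (induction xs)
  case Nil
  show ?case by (auto intro!: S4.taut simp: tautology_def)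
next
  case (Cons x xs)
  let ?R = "imps xs A" and ?Q = "imps (map Box xs) (Box A)"
  have "tautology (Imp (Imp (Box (Imp x ?R)) (Imp (Box x) (Box ?R)))
      (Imp (Imp (Box ?R) ?Q) (Imp (Box (Imp x ?R)) (Imp (Box x) ?Q))))"
    unfolding tautology_def by simp
  from S4.mp[OF S4.mp[OF S4.taut[OF this] S4.ax_K] Cons] show ?case
    by simp
qed

section \<open>Maximal consistent sets\<close>

definition maximal_consistent :: "fm set \<Rightarrow> bool" where
  "maximal_consistent X \<longleftrightarrow> \<not> derives X Bot \<and> (\<forall>A. A \<in> X \<or> Neg A \<in> X)"

text \<open>Zorn's lemma applies because a derivation uses finitely many premises: if the union of a
  chain is inconsistent, so is one of its members.\<close>

lemma lindenbaum:
  assumes "\<not> derives X Bot"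
  obtains Y where "X \<subseteq> Y" "maximal_consistent Y"
proof -
  let ?S = "{Y. X \<subseteq> Y \<and> \<not> derives Y Bot}"
  have "\<exists>Y\<in>?S. \<forall>Z\<in>?S. Y \<subseteq> Z \<longrightarrow> Z = Y"
  proof (rule subset_Zorn_nonempty)
    show "?S \<noteq> {}" using assms by blast
  next
    fix C assume C: "C \<noteq> {}" "subset.chain ?S C"
    have "\<not> derives (\<Union>C) Bot"
    proof
      assume "derives (\<Union>C) Bot"
      then obtain xs where "set xs \<subseteq> \<Union>C" "S4 (imps xs Bot)"
        unfolding derives_def by blast
      moreover from this(1) obtain Z where "Z \<in> C" "set xs \<subseteq> Z"
        using finite_subset_Union_chain[of "set xs" C ?S] C by auto
      ultimately show False
        using C(2) unfolding subset_chain_def derives_def by blast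
    qed
    then show "\<Union>C \<in> ?S"
      using C unfolding subset_chain_def by blast
  qed
  then obtain Y where Y: "X \<subseteq> Y" "\<not> derives Y Bot"
    and max: "\<forall>Z\<in>?S. Y \<subseteq> Z \<longrightarrow> Z = Y"
    by blast
  have "A \<in> Y \<or> Neg A \<in> Y" for A
  proof (rule ccontr)
    assume A: "\<not> (A \<in> Y \<or> Neg A \<in> Y)"
    \<comment> \<open>By maximality, adding a missing formula destroys consistency; if
      \<open>A\<close> and \<open>Neg A\<close> were both missing, \<open>Y\<close> would refute
      both.\<close>
    have "derives (insert B Y) Bot" if "B \<notin> Y" for B
      using max Y(1) that by blast
    then have "derives Y (Imp A Bot)" "derives Y (Imp (Neg A) Bot)"
      using A derives_deduction by blast+
    then have "derives Y Bot"
      by (rule derives_taut2) (simp add: tautology_def)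
    with Y(2) show False ..
  qed
  then show ?thesis using that Y unfolding maximal_consistent_def by blast
qed

context
  fixes X assumes X: "maximal_consistent X"
begin

lemma mcs_derives: "A \<in> X \<longleftrightarrow> derives X A"
proof
  assume A: "derives X A"
  show "A \<in> X"
  proof (rule ccontr)
    assume "A \<notin> X"
    then have "derives X (Neg A)"
      using X derives_assm unfolding maximal_consistent_def by blast
    then have "derives X Bot"
      by (rule derives_taut2[OF A]) (simp add: tautology_def)
    then show False using X unfolding maximal_consistent_def by blast
  qed
qed (rule derives_assm)

lemma mcs_taut1: "A \<in> X \<Longrightarrow> tautology (Imp A C) \<Longrightarrow> C \<in> X"
  unfolding mcs_derives by (rule derives_taut1)

lemma mcs_taut2: "A \<in> X \<Longrightarrow> B \<in> X \<Longrightarrow> tautology (Imp A (Imp B C)) \<Longrightarrow> C \<in> X"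
  unfolding mcs_derives by (rule derives_taut2)

lemma mcs_Bot: "Bot \<notin> X"
  using X unfolding mcs_derives maximal_consistent_def by blast

lemma mcs_Neg: "Neg A \<in> X \<longleftrightarrow> A \<notin> X"
proof -
  have "A \<in> X \<Longrightarrow> Neg A \<in> X \<Longrightarrow> Bot \<in> X"
    by (erule mcs_taut2) (auto simp: tautology_def)
  then show ?thesis using X mcs_Bot unfolding maximal_consistent_def by blast
qed

lemma mcs_And: "And A B \<in> X \<longleftrightarrow> A \<in> X \<and> B \<in> X"
proof -
  have "A \<in> X \<Longrightarrow> B \<in> X \<Longrightarrow> And A B \<in> X"
    by (erule mcs_taut2) (auto simp: tautology_def)
  moreover have "And A B \<in> X \<Longrightarrow> A \<in> X" "And A B \<in> X \<Longrightarrow> B \<in> X"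
    by (erule mcs_taut1, simp add: tautology_def)+
  ultimately show ?thesis by blast
qed

lemma mcs_Or: "Or A B \<in> X \<longleftrightarrow> A \<in> X \<or> B \<in> X"
proof -
  have "Neg (Or A B) \<in> X \<longleftrightarrow> And (Neg A) (Neg B) \<in> X"
    by (rule iffI; erule mcs_taut1) (auto simp: tautology_def)
  then show ?thesis unfolding mcs_Neg mcs_And by blast
qed

lemma mcs_Imp: "Imp A B \<in> X \<longleftrightarrow> (A \<in> X \<longrightarrow> B \<in> X)"
proof -
  have "Imp A B \<in> X \<longleftrightarrow> Or (Neg A) B \<in> X"
    by (rule iffI; erule mcs_taut1) (auto simp: tautology_def)
  then show ?thesis by (simp add: mcs_Neg mcs_Or)
qed

lemma mcs_S4: "S4 A \<Longrightarrow> A \<in> X"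
  unfolding mcs_derives by (rule derives_S4)

end

section \<open>The canonical model\<close>

definition canonical :: "fm set kripke" where
  "canonical =
     \<lparr>worlds = {X. maximal_consistent X},
      acc = (\<lambda>X Y. \<forall>A. Box A \<in> X \<longrightarrow> A \<in> Y),
      val = (\<lambda>X i. Var i \<in> X)\<rparr>"

lemma preorder_canonical: "preorder_model canonical"
proof -
  have T: "A \<in> X" if "maximal_consistent X" "Box A \<in> X" for X A
    using mcs_S4[OF that(1) ax_T[of A]] mcs_Imp[OF that(1)] that(2) by blast
  have "Box (Box A) \<in> X" if "maximal_consistent X" "Box A \<in> X" for X A
    using mcs_S4[OF that(1) ax_4[of A]] mcs_Imp[OF that(1)] that(2) by blast
  with T show ?thesis
    unfolding preorder_model_def canonical_def kripke.simps mem_Collect_eq by blast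
qed

text \<open>If the unboxed formulas of \<open>X\<close> were inconsistent with \<open>Neg A\<close>,
  boxing the derivation would put \<open>Box A\<close> into \<open>X\<close>.\<close>

lemma canonical_witness:
  assumes "maximal_consistent X" "Box A \<notin> X"
  obtains Y where "maximal_consistent Y" "\<forall>B. Box B \<in> X \<longrightarrow> B \<in> Y" "A \<notin> Y"
proof -
  let ?U = "{B. Box B \<in> X}"
  have "\<not> derives (insert (Neg A) ?U) Bot"
  proof
    assume "derives (insert (Neg A) ?U) Bot"
    then have "derives ?U (Imp (Neg A) Bot)" by (rule derives_deduction)
    then have "derives ?U A" by (rule derives_taut1) (simp add: tautology_def)
    then obtain xs where xs: "set xs \<subseteq> ?U" "S4 (imps xs A)"
      unfolding derives_def by blast
    then have "S4 (imps (map Box xs) (Box A))"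
      using S4_Box_imps S4.nec S4.mp by blast
    moreover have "set (map Box xs) \<subseteq> X" using xs(1) by auto
    ultimately have "derives X (Box A)" unfolding derives_def by blast
    then show False using assms mcs_derives by blast
  qed
  then obtain Y where "insert (Neg A) ?U \<subseteq> Y" "maximal_consistent Y"
    by (rule lindenbaum)
  then show ?thesis using that[of Y] mcs_Neg[of Y A] by auto
qed

lemma truth_lemma: "maximal_consistent X \<Longrightarrow> sat canonical X A \<longleftrightarrow> A \<in> X"
proof (induction A arbitrary: X)
  case (Var i)
  then show ?case by (simp add: canonical_def)
next
  case (Box A)
  then show ?case
    using canonical_witness[of X A] by (auto simp: canonical_def)
qed (simp_all add: mcs_Bot mcs_Neg mcs_And mcs_Or mcs_Imp)

lemma S4_complete:
  assumes "\<And>X. X \<in> worlds canonical \<Longrightarrow> sat canonical X A"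
  shows "S4 A"
proof (rule ccontr)
  assume nA: "\<not> S4 A"
  have "\<not> derives {Neg A} Bot"
  proof
    assume "derives {Neg A} Bot"
    then have "derives {} (Imp (Neg A) Bot)" by (rule derives_deduction)
    then have "derives {} A" by (rule derives_taut1) (simp add: tautology_def)
    with nA show False unfolding derives_def by simp
  qed
  then obtain X where "{Neg A} \<subseteq> X" and X: "maximal_consistent X"
    by (rule lindenbaum)
  moreover have "A \<in> X"
    using assms[of X] X truth_lemma[OF X] by (simp add: canonical_def)
  ultimately show False using mcs_Neg[OF X] by blast
qed

section \<open>Semantics of substitutions and disjuncts\<close>

text \<open>The operation on models dual to \<open>subst\<close>: substituting in a formula amounts
  to changing the valuation on the same frame.\<close>

definition subst_model :: "(nat \<Rightarrow> fm) \<Rightarrow> 'w kripke \<Rightarrow> 'w kripke" where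
  "subst_model \<sigma> M = \<lparr>worlds = worlds M, acc = acc M, val = (\<lambda>w i. sat M w (\<sigma> i))\<rparr>"

lemma subst_model_simps [simp]:
  "worlds (subst_model \<sigma> M) = worlds M"
  "acc (subst_model \<sigma> M) = acc M"
  "val (subst_model \<sigma> M) w i = sat M w (\<sigma> i)"
  by (simp_all add: subst_model_def)

lemma preorder_subst_model [simp]: "preorder_model (subst_model \<sigma> M) = preorder_model M"
  by (simp add: preorder_model_def)

lemma sat_subst: "sat M w (subst \<sigma> A) = sat (subst_model \<sigma> M) w A"
  by (induction A arbitrary: w) auto

lemma sat_subst_funpow: "sat M w ((subst \<sigma> ^^ k) A) = sat ((subst_model \<sigma> ^^ k) M) w A"
  by (induction k arbitrary: M) (simp_all add: sat_subst flip: funpow_swap1[of "subst_model \<sigma>"])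

lemma subst_Var: "subst Var A = A"
  by (induction A) auto

lemma subst_subst: "subst \<sigma> (subst \<tau> A) = subst (\<lambda>i. subst \<sigma> (\<tau> i)) A"
  by (induction A) auto

text \<open>Needed to treat an iterated repair as one substitution.\<close>

lemma subst_funpow: "(subst \<sigma> ^^ k) A = subst (\<lambda>i. (subst \<sigma> ^^ k) (Var i)) A"
proof (induction k)
  case (Suc k)
  then show ?case unfolding funpow.simps comp_def by (metis subst_subst)
qed (simp add: subst_Var)

lemma sat_Conj: "sat M w (Conj As) \<longleftrightarrow> (\<forall>A\<in>set As. sat M w A)"
  by (induction As rule: Conj.induct) auto

lemma sat_Disj: "sat M w (Disj As) \<longleftrightarrow> (\<exists>A\<in>set As. sat M w A)"
  by (induction As rule: Disj.induct) auto

lemma sat_lit: "sat M w (lit A b) \<longleftrightarrow> sat M w A = b"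
  by (simp add: lit_def)

lemma sat_BigDisj: "finite I \<Longrightarrow> sat M w (BigDisj \<phi> I) \<longleftrightarrow> (\<exists>\<psi>\<in>\<phi> ` I. sat M w \<psi>)"
  by (simp add: BigDisj_def sat_Disj)

section \<open>The disjunct realized at a world\<close>

definition true_vars :: "nat \<Rightarrow> 'w kripke \<Rightarrow> 'w \<Rightarrow> nat set" where
  "true_vars n M w = {i \<in> {1..n}. val M w i}"

definition seen_vars :: "nat \<Rightarrow> 'w kripke \<Rightarrow> 'w \<Rightarrow> nat set" where
  "seen_vars n M w = (\<Union>u\<in>{u \<in> worlds M. acc M w u}. true_vars n M u)"

text \<open>A disjunct fixes the truth value of each variable and of its diamond. Later arguments
  can therefore compute with sets of variables instead of formulas.\<close>

lemma sat_Theta: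
  assumes "\<psi> \<in> Theta n"
  shows "sat M w \<psi> \<longleftrightarrow> true_vars n M w = theta n \<psi> \<and> seen_vars n M w = theta_dia n \<psi>"
proof -
  obtain t where t: "\<psi> = disjunct n t" using assms by (auto simp: Theta_def)
  have upt: "set [1..<Suc n] = {1..n}"
    by (simp only: set_upt atLeastLessThanSuc_atLeastAtMost)
  have "sat M w \<psi> \<longleftrightarrow> (\<forall>i\<in>{1..n}. val M w i = t i 0) \<and>
      (\<forall>i\<in>{1..n}. (\<exists>u\<in>worlds M. acc M w u \<and> val M u i) = t i 1)"
    unfolding t disjunct_def
    by (simp only: sat.simps sat_Conj set_map upt ball_simps sat_lit sat_Dia)
  then show ?thesis
    unfolding t theta_disjunct theta_dia_disjunct true_vars_def seen_vars_def set_eq_iff by blast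
qed

lemma theta_subset: "theta n \<psi> \<subseteq> {1..n}"
  by (auto simp: theta_def)

lemma true_vars_subset_seen_vars:
  "preorder_model M \<Longrightarrow> w \<in> worlds M \<Longrightarrow> true_vars n M w \<subseteq> seen_vars n M w"
  unfolding preorder_model_def seen_vars_def by blast

lemma seen_vars_antimono:
  assumes "preorder_model M" "w \<in> worlds M" "u \<in> worlds M" "acc M w u"
  shows "seen_vars n M u \<subseteq> seen_vars n M w"
  using assms unfolding preorder_model_def seen_vars_def by blast

lemma MTheta_simps [simp]:
  "worlds (MTheta n W) = W"
  "acc (MTheta n W) \<psi> \<chi> \<longleftrightarrow> theta_dia n \<chi> \<subseteq> theta_dia n \<psi>"
  "val (MTheta n W) \<psi> i \<longleftrightarrow> i \<in> theta n \<psi>"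
  by (simp_all add: MTheta_def)

lemma preorder_MTheta: "preorder_model (MTheta n W)"
  unfolding preorder_model_def MTheta_simps by blast

lemma true_vars_MTheta: "true_vars n (MTheta n W) \<psi> = theta n \<psi>"
  using theta_subset[of n \<psi>] by (auto simp: true_vars_def)

section \<open>From a rejecting substitution to a set of disjuncts\<close>

text \<open>The root \<open>None\<close> sees itself and the cones above \<open>S\<close>, and no
  old world sees it. The value \<open>False\<close> at the root is a mere default.\<close>

definition add_root :: "'w kripke \<Rightarrow> 'w set \<Rightarrow> 'w option kripke" where
  "add_root M S =
     \<lparr>worlds = insert None (Some ` worlds M),
      acc = (\<lambda>x y. case y of None \<Rightarrow> x = None
        | Some v \<Rightarrow> (case x of None \<Rightarrow> \<exists>u\<in>S. acc M u v | Some u \<Rightarrow> acc M u v)),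
      val = (\<lambda>x i. case x of None \<Rightarrow> False | Some w \<Rightarrow> val M w i)\<rparr>"

text \<open>The old worlds form a generated submodel.\<close>

lemma sat_add_root: "sat (add_root M S) (Some w) A = sat M w A"
  by (induction A arbitrary: w) (simp_all add: add_root_def)

lemma preorder_add_root:
  assumes M: "preorder_model M" and S: "S \<subseteq> worlds M"
  shows "preorder_model (add_root M S)"
proof -
  have *: "\<exists>x\<in>S. acc M x w"
    if "u \<in> S" "acc M u v" "acc M v w" "v \<in> worlds M" "w \<in> worlds M" for u v w
    using that M S unfolding preorder_model_def by blast
  show ?thesis
    unfolding preorder_model_def add_root_def kripke.simps ball_simps option.simps
    using M[unfolded preorder_model_def] * by blast
qed

lemma seen_vars_add_root:
  assumes "S \<subseteq> worlds M"
  shows "seen_vars n (subst_model \<sigma> (add_root M S)) None =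
    true_vars n (subst_model \<sigma> (add_root M S)) None \<union>
    (\<Union>u\<in>S. seen_vars n (subst_model \<sigma> M) u)"
proof -
  let ?E = "add_root M S"
  have "{x \<in> worlds ?E. acc ?E None x} =
      insert None (Some ` (\<Union>u\<in>S. {v \<in> worlds M. acc M u v}))"
    unfolding add_root_def by auto
  moreover have "true_vars n (subst_model \<sigma> ?E) (Some v) = true_vars n (subst_model \<sigma> M) v" for v
    by (simp add: true_vars_def sat_add_root)
  ultimately show ?thesis
    unfolding seen_vars_def subst_model_simps by auto
qed

text \<open>The three claims are read off from a canonical world refuting \<open>\<sigma> 1\<close>,
  from canonical worlds realizing the members of \<open>W\<close>, and from a new root.\<close>

lemma rejecting_subst_realizes:
  assumes I: "finite I" "\<phi> ` I \<subseteq> Theta n"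
    and prem: "S4 (subst \<sigma> (BigDisj \<phi> I))"
    and concl: "\<not> S4 (\<sigma> 1)"
    and n: "n \<ge> 1"
  defines "W \<equiv> {\<psi> \<in> \<phi> ` I. \<not> S4 (Neg (subst \<sigma> \<psi>))}"
  shows "\<exists>\<psi>\<in>W. \<not> sat (MTheta n W) \<psi> (Var 1)"
    and "\<forall>\<psi>\<in>W. sat (MTheta n W) \<psi> \<psi>"
    and "\<forall>D. D \<subseteq> W \<longrightarrow>
      (\<exists>\<psi>\<in>W. theta_dia n \<psi> = theta n \<psi> \<union> (\<Union>\<chi>\<in>D. theta_dia n \<chi>))"
proof -
  \<comment> \<open>By soundness the premise holds at every world. The type of worlds is arbitrary
    because this is applied both to the canonical model and to its extension by a root.\<close>
  have realized: "\<exists>\<psi>\<in>W. sat (subst_model \<sigma> M) w \<psi>"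
    if M: "preorder_model M" "w \<in> worlds M" for M :: "'w kripke" and w
  proof -
    from S4_sound[OF prem M] obtain \<psi> where \<psi>: "\<psi> \<in> \<phi> ` I" "sat (subst_model \<sigma> M) w \<psi>"
      unfolding sat_subst sat_BigDisj[OF I(1)] ..
    moreover have "\<not> S4 (Neg (subst \<sigma> \<psi>))"
    proof
      assume "S4 (Neg (subst \<sigma> \<psi>))"
      from S4_sound[OF this M] show False using \<psi>(2) by (simp add: sat_subst)
    qed
    ultimately show ?thesis unfolding W_def by blast
  qed
  let ?C = "subst_model \<sigma> canonical"
  have C: "preorder_model ?C" by (simp add: preorder_canonical)
  have Theta: "\<psi> \<in> Theta n" if "\<psi> \<in> W" for \<psi>
    using that I(2) unfolding W_def by blast
  have realized': "\<exists>\<psi>\<in>W. true_vars n ?C X = theta n \<psi> \<and> seen_vars n ?C X = theta_dia n \<psi>"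
    if "X \<in> worlds ?C" for X
  proof -
    obtain \<psi> where \<psi>: "\<psi> \<in> W" "sat ?C X \<psi>"
      using realized[OF preorder_canonical] \<open>X \<in> worlds ?C\<close> unfolding subst_model_simps by blast
    then show ?thesis using sat_Theta[OF Theta[OF \<psi>(1)], of ?C X] by blast
  qed
  have witness: "\<exists>X\<in>worlds ?C. sat ?C X \<psi> \<and> true_vars n ?C X = theta n \<psi> \<and>
      seen_vars n ?C X = theta_dia n \<psi>" if \<psi>: "\<psi> \<in> W" for \<psi>
  proof -
    have "\<not> S4 (Neg (subst \<sigma> \<psi>))" using \<psi> unfolding W_def by blast
    then obtain X where "X \<in> worlds canonical" "\<not> sat canonical X (Neg (subst \<sigma> \<psi>))"
      using S4_complete by blast
    then have "X \<in> worlds ?C" "sat ?C X \<psi>" by (simp_all add: sat_subst)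
    then show ?thesis using sat_Theta[OF Theta[OF \<psi>], of ?C X] by blast
  qed
  show "\<exists>\<psi>\<in>W. \<not> sat (MTheta n W) \<psi> (Var 1)"
  proof -
    obtain X where X: "X \<in> worlds canonical" "\<not> sat canonical X (\<sigma> 1)"
      using concl S4_complete by blast
    obtain \<psi> where \<psi>: "\<psi> \<in> W" "true_vars n ?C X = theta n \<psi>"
      using realized'[of X] X(1) by auto
    have "1 \<notin> true_vars n ?C X"
      using X(2) by (simp add: true_vars_def)
    with \<psi> show ?thesis by auto
  qed
  show "\<forall>\<psi>\<in>W. sat (MTheta n W) \<psi> \<psi>"
  proof
    fix \<psi> assume \<psi>: "\<psi> \<in> W"
    obtain X where X: "X \<in> worlds ?C" "true_vars n ?C X = theta n \<psi>" "seen_vars n ?C X = theta_dia n \<psi>"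
      using witness[OF \<psi>] by blast
    \<comment> \<open>A variable possible at \<open>\<psi>\<close> is true at a canonical successor
      \<open>Y\<close> of \<open>X\<close>; the disjunct realized at \<open>Y\<close> is the
      required successor of \<open>\<psi>\<close>.\<close>
    have "theta_dia n \<psi> \<subseteq> seen_vars n (MTheta n W) \<psi>"
    proof
      fix i assume "i \<in> theta_dia n \<psi>"
      then obtain Y where Y: "Y \<in> worlds ?C" "acc ?C X Y" "i \<in> true_vars n ?C Y"
        using X(3) unfolding seen_vars_def by blast
      obtain \<chi> where \<chi>: "\<chi> \<in> W" "true_vars n ?C Y = theta n \<chi>" "seen_vars n ?C Y = theta_dia n \<chi>"
        using realized'[OF Y(1)] by blast
      moreover have "theta_dia n \<chi> \<subseteq> theta_dia n \<psi>"
        using seen_vars_antimono[OF C X(1) Y(1,2), of n] X(3) \<chi>(3) by simp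
      ultimately show "i \<in> seen_vars n (MTheta n W) \<psi>"
        using Y(3) unfolding seen_vars_def true_vars_MTheta MTheta_simps by blast
    qed
    moreover have "theta n \<chi> \<subseteq> theta_dia n \<chi>" if \<chi>: "\<chi> \<in> W" for \<chi>
      using witness[OF \<chi>] true_vars_subset_seen_vars[OF C] by metis
    then have "seen_vars n (MTheta n W) \<psi> \<subseteq> theta_dia n \<psi>"
      unfolding seen_vars_def true_vars_MTheta MTheta_simps by blast
    ultimately show "sat (MTheta n W) \<psi> \<psi>"
      unfolding sat_Theta[OF Theta[OF \<psi>]] true_vars_MTheta by (intro conjI refl equalityI)
  qed
  show "\<forall>D. D \<subseteq> W \<longrightarrow>
      (\<exists>\<psi>\<in>W. theta_dia n \<psi> = theta n \<psi> \<union> (\<Union>\<chi>\<in>D. theta_dia n \<chi>))"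
  proof (intro allI impI)
    fix D assume D: "D \<subseteq> W"
    \<comment> \<open>All canonical worlds realizing a member of \<open>D\<close>; for empty
      \<open>D\<close> the new root sees only itself.\<close>
    let ?S = "{X \<in> worlds canonical. \<exists>\<chi>\<in>D. sat ?C X \<chi>}"
    let ?E = "add_root canonical ?S"
    have S: "?S \<subseteq> worlds canonical" by blast
    have "None \<in> worlds ?E" by (simp add: add_root_def)
    with realized[OF preorder_add_root[OF preorder_canonical S]]
    obtain \<psi> where \<psi>: "\<psi> \<in> W" "sat (subst_model \<sigma> ?E) None \<psi>"
      by blast
    have "(\<Union>X\<in>?S. seen_vars n ?C X) = (\<Union>\<chi>\<in>D. theta_dia n \<chi>)"
    proof (intro equalityI UN_least)
      fix X assume "X \<in> ?S"
      then obtain \<chi> where "\<chi> \<in> D" "sat ?C X \<chi>" by blast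
      moreover from this have "seen_vars n ?C X = theta_dia n \<chi>"
        using D sat_Theta[OF Theta, of \<chi> ?C X] by blast
      ultimately show "seen_vars n ?C X \<subseteq> (\<Union>\<chi>\<in>D. theta_dia n \<chi>)" by blast
    next
      fix \<chi> assume \<chi>: "\<chi> \<in> D"
      then have "\<chi> \<in> W" using D by blast
      from witness[OF this] obtain X
        where "X \<in> worlds ?C" "sat ?C X \<chi>" "seen_vars n ?C X = theta_dia n \<chi>" by blast
      moreover from this(1,2) have "X \<in> ?S" using \<chi> by auto
      ultimately show "theta_dia n \<chi> \<subseteq> (\<Union>X\<in>?S. seen_vars n ?C X)" by blast
    qed
    then have "theta_dia n \<psi> = theta n \<psi> \<union> (\<Union>\<chi>\<in>D. theta_dia n \<chi>)"
      using \<psi>(2) unfolding sat_Theta[OF Theta[OF \<psi>(1)]] seen_vars_add_root[OF S] by (elim conjE) simp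
    with \<psi>(1) show "\<exists>\<psi>\<in>W. theta_dia n \<psi> = theta n \<psi> \<union> (\<Union>\<chi>\<in>D. theta_dia n \<chi>)" ..
  qed
qed

section \<open>From a set of disjuncts to a rejecting substitution\<close>

text \<open>Reflexivity puts \<open>w\<close> itself into its cone, and transitivity keeps the cones
  of its successors inside.\<close>

lemma sat_upset_cong:
  assumes "preorder_model M" "worlds N = worlds M" "acc N = acc M"
    and "w \<in> worlds M" "\<forall>u\<in>worlds M. acc M w u \<longrightarrow> val N u = val M u"
  shows "sat N w A = sat M w A"
  using assms(4,5)
proof (induction A arbitrary: w)
  case (Var i)
  then show ?case using assms(1) unfolding preorder_model_def sat.simps by metis
next
  case (Box A)
  have "sat N u A = sat M u A" if "u \<in> worlds M" "acc M w u" for u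
    using Box.IH[of u] Box.prems that assms(1) unfolding preorder_model_def by blast
  then show ?case using assms(2,3) by simp
qed auto

text \<open>\<open>ws\<close> lists the finite set \<open>W\<close>, so that disjunctions over it
  are formulas; \<open>d\<close> chooses the witnesses of condition (3).\<close>

locale disjunct_choice =
  fixes n :: nat and ws :: "fm list" and d :: "fm set \<Rightarrow> fm"
  assumes ws: "set ws \<subseteq> Theta n"
    and d_in: "D \<subseteq> set ws \<Longrightarrow> d D \<in> set ws"
    and d_dia: "D \<subseteq> set ws \<Longrightarrow> theta_dia n (d D) = theta n (d D) \<union> (\<Union>\<chi>\<in>D. theta_dia n \<chi>)"
begin

definition settled :: fm where
  "settled = Box (Disj ws)"

definition reaches :: "fm \<Rightarrow> fm" where
  "reaches \<psi> = Dia (And settled \<psi>)"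

definition reached :: "'w kripke \<Rightarrow> 'w \<Rightarrow> fm set" where
  "reached M w = {\<psi> \<in> set ws. sat M w (reaches \<psi>)}"

text \<open>The set of reached disjuncts has finitely many possible values, enumerated by
  \<open>subseqs\<close>. Each inner conjunction says that this set is exactly \<open>set D\<close>,
  so the choice \<open>d\<close> becomes definable by a formula.\<close>

definition repair :: "nat \<Rightarrow> fm" where
  "repair i = Or (And settled (Var i)) (And (Neg settled)
     (Disj (map (\<lambda>D. Conj (map (\<lambda>\<psi>. lit (reaches \<psi>) (\<psi> \<in> set D)) ws))
       (filter (\<lambda>D. i \<in> theta n (d (set D))) (subseqs ws)))))"

lemma sat_settled:
  "sat M w settled \<longleftrightarrow> (\<forall>u\<in>worlds M. acc M w u \<longrightarrow> (\<exists>\<psi>\<in>set ws. sat M u \<psi>))"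
  by (simp add: settled_def sat_Disj)

lemma sat_reaches:
  "sat M w (reaches \<psi>) \<longleftrightarrow> (\<exists>u\<in>worlds M. acc M w u \<and> sat M u settled \<and> sat M u \<psi>)"
  by (simp add: reaches_def sat_Dia)

lemma reached_subset: "reached M w \<subseteq> set ws"
  by (auto simp: reached_def)

lemma sat_repair:
  "sat M w (repair i) =
    (if sat M w settled then val M w i else i \<in> theta n (d (reached M w)))"
proof -
  let ?A = "\<lambda>D. Conj (map (\<lambda>\<psi>. lit (reaches \<psi>) (\<psi> \<in> set D)) ws)"
  have A: "sat M w (?A D) \<longleftrightarrow> set D = reached M w" if "D \<in> set (subseqs ws)" for D
  proof -
    have "set D \<subseteq> set ws" using that subseqs_powset[of ws] by blast
    then show ?thesis
      unfolding reached_def by (auto simp: sat_Conj sat_lit)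
  qed
  obtain D where D: "D \<in> set (subseqs ws)" "set D = reached M w"
    using reached_subset[of M w] subseqs_powset[of ws] by (metis PowI imageE)
  have "(\<exists>D\<in>set (subseqs ws). i \<in> theta n (d (set D)) \<and> sat M w (?A D))
      \<longleftrightarrow> i \<in> theta n (d (reached M w))"
    using A D by metis
  then show ?thesis
    by (simp add: repair_def sat_Disj Bex_def conj_assoc)
qed

section \<open>The effect of one repair\<close>

lemma settled_upward:
  assumes "preorder_model M" "w \<in> worlds M" "u \<in> worlds M" "acc M w u" "sat M w settled"
  shows "sat M u settled"
  using assms unfolding preorder_model_def sat_settled by blast

lemma reached_antimono:
  assumes "preorder_model M" "w \<in> worlds M" "u \<in> worlds M" "acc M w u"
  shows "reached M u \<subseteq> reached M w"
  using assms unfolding preorder_model_def reached_def sat_reaches by blast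

text \<open>All successors of a settled world are settled, so the valuation does not change on its
  cone.\<close>

lemma settled_preserved:
  assumes "preorder_model M" "w \<in> worlds M" "sat M w settled"
  shows "sat (subst_model repair M) w A = sat M w A"
proof (rule sat_upset_cong)
  show "\<forall>u\<in>worlds M. acc M w u \<longrightarrow> val (subst_model repair M) u = val M u"
    using settled_upward[OF assms(1,2) _ _ assms(3)] by (simp add: fun_eq_iff sat_repair)
qed (use assms in simp_all)

text \<open>The witnesses of \<open>reaches\<close> are settled worlds, where no formula changes its
  truth value.\<close>

lemma reached_mono:
  assumes "preorder_model M" "w \<in> worlds M"
  shows "reached M w \<subseteq> reached (subst_model repair M) w"
  using settled_preserved[OF assms(1)] unfolding reached_def sat_reaches by fastforce

lemma settled_vars:
  assumes M: "preorder_model M" and w: "w \<in> worlds M" "sat M w settled"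
  obtains \<psi> where "\<psi> \<in> reached M w" "seen_vars n M w = theta_dia n \<psi>"
proof -
  have refl: "acc M w w" using M w unfolding preorder_model_def by blast
  then obtain \<psi> where \<psi>: "\<psi> \<in> set ws" "sat M w \<psi>"
    using w unfolding sat_settled by blast
  then have "\<psi> \<in> reached M w"
    using w refl unfolding reached_def sat_reaches by blast
  then show ?thesis using that \<psi> ws sat_Theta[of \<psi> n M w] by blast
qed

text \<open>Computes what the settled successors contribute to the seen variables; it is the union
  occurring in \<open>d_dia\<close>.\<close>

lemma reached_vars:
  assumes M: "preorder_model M" and w: "w \<in> worlds M"
  shows "(\<Union>u\<in>{u \<in> worlds M. acc M w u \<and> sat M u settled}. true_vars n M u) =
    (\<Union>\<chi>\<in>reached M w. theta_dia n \<chi>)" (is "?L = ?R")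
proof
  show "?L \<subseteq> ?R"
  proof (rule UN_least)
    fix u assume u: "u \<in> {u \<in> worlds M. acc M w u \<and> sat M u settled}"
    then obtain \<psi> where "\<psi> \<in> reached M u" "seen_vars n M u = theta_dia n \<psi>"
      using settled_vars[OF M] by blast
    moreover have "reached M u \<subseteq> reached M w"
      using reached_antimono[OF M w] u by blast
    ultimately show "true_vars n M u \<subseteq> ?R"
      using true_vars_subset_seen_vars[OF M, of u n] u by blast
  qed
  show "?R \<subseteq> ?L"
  proof (rule UN_least)
    fix \<chi> assume "\<chi> \<in> reached M w"
    then obtain u where \<chi>: "\<chi> \<in> set ws" and u: "u \<in> worlds M" "acc M w u" "sat M u settled" "sat M u \<chi>"
      unfolding reached_def sat_reaches by blast
    have "theta_dia n \<chi> = seen_vars n M u"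
      using sat_Theta[of \<chi> n M u] \<chi> ws u by blast
    moreover have "v \<in> worlds M \<and> acc M w v \<and> sat M v settled" if "v \<in> worlds M" "acc M u v" for v
      using that u w settled_upward[OF M u(1) that u(3)] M unfolding preorder_model_def by blast
    ultimately show "theta_dia n \<chi> \<subseteq> ?L"
      unfolding seen_vars_def by blast
  qed
qed

text \<open>If all unsettled successors of a world reach the same disjuncts, they all receive the same
  value, which is then correct, so the world becomes settled.\<close>

lemma repair_progress:
  assumes M: "preorder_model M" and w: "w \<in> worlds M"
    and unsettled: "\<not> sat (subst_model repair M) w settled"
  shows "\<exists>v\<in>worlds M. acc M w v \<and> \<not> sat M v settled \<and> reached M v \<subset> reached M w"
proof (rule ccontr)
  assume no: "\<not> ?thesis"
  \<comment> \<open>Along accessibility \<open>reached\<close> can only shrink, so without a proper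
    decrease it is constant.\<close>
  have same: "reached M v = reached M w" if "v \<in> worlds M" "acc M w v" "\<not> sat M v settled" for v
    using that reached_antimono[OF M w] no by blast
  let ?N = "subst_model repair M"
  let ?\<psi> = "d (reached M w)"
  note D = reached_subset[of M w]
  have tv_settled: "true_vars n ?N u = true_vars n M u" if "sat M u settled" for u
    using that by (simp add: true_vars_def sat_repair)
  have tv_unsettled: "true_vars n ?N u = theta n (d (reached M u))" if "\<not> sat M u settled" for u
    using that theta_subset[of n "d (reached M u)"] by (auto simp: true_vars_def sat_repair)
  have "\<exists>\<psi>\<in>set ws. sat ?N v \<psi>" if v: "v \<in> worlds M" "acc M w v" for v
  proof (cases "sat M v settled")
    case True
    have "acc M v v" using M v unfolding preorder_model_def by blast
    with True v obtain \<psi> where "\<psi> \<in> set ws" "sat M v \<psi>"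
      unfolding sat_settled by blast
    then show ?thesis using settled_preserved[OF M v(1) True] by blast
  next
    case False
    have refl: "acc M v v" using M v unfolding preorder_model_def by blast
    have same_v: "reached M u = reached M w"
      if "u \<in> worlds M" "acc M v u" "\<not> sat M u settled" for u
      using same that v w M unfolding preorder_model_def by blast
    \<comment> \<open>Settled successors contribute the union over the reached disjuncts, unsettled
      ones contribute \<open>theta n ?\<psi>\<close>; \<open>d_dia\<close> says that together these
      are \<open>theta_dia n ?\<psi>\<close>.\<close>
    have "seen_vars n ?N v =
        (\<Union>u\<in>{u \<in> worlds M. acc M v u \<and> sat M u settled}. true_vars n ?N u) \<union>
        (\<Union>u\<in>{u \<in> worlds M. acc M v u \<and> \<not> sat M u settled}. true_vars n ?N u)"
      unfolding seen_vars_def subst_model_simps by blast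
    also have "(\<Union>u\<in>{u \<in> worlds M. acc M v u \<and> sat M u settled}. true_vars n ?N u) =
        (\<Union>u\<in>{u \<in> worlds M. acc M v u \<and> sat M u settled}. true_vars n M u)"
      by (rule SUP_cong) (use tv_settled in auto)
    also have "\<dots> = (\<Union>\<chi>\<in>reached M w. theta_dia n \<chi>)"
      using reached_vars[OF M v(1)] same[OF v False] by simp
    also have "(\<Union>u\<in>{u \<in> worlds M. acc M v u \<and> \<not> sat M u settled}. true_vars n ?N u) = theta n ?\<psi>"
    proof -
      have "true_vars n ?N u = theta n ?\<psi>"
        if "u \<in> {u \<in> worlds M. acc M v u \<and> \<not> sat M u settled}" for u
        using that tv_unsettled[of u] same_v[of u] by simp
      \<comment> \<open>The index set of the union is nonempty, as it contains
        \<open>v\<close>.\<close>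
      moreover have "v \<in> {u \<in> worlds M. acc M v u \<and> \<not> sat M u settled}"
        using v refl False by blast
      ultimately show ?thesis by blast
    qed
    finally have "seen_vars n ?N v = theta_dia n ?\<psi>"
      using d_dia[OF D] by blast
    moreover have "true_vars n ?N v = theta n ?\<psi>"
      using tv_unsettled[OF False] same[OF v False] by simp
    ultimately show ?thesis
      using d_in[OF D] ws sat_Theta[of ?\<psi> n ?N v] by blast
  qed
  with unsettled show False unfolding sat_settled subst_model_simps by blast
qed

section \<open>Iterating the repair\<close>

lemma preorder_repair_funpow: "preorder_model ((subst_model repair ^^ k) M) = preorder_model M"
  and worlds_repair_funpow: "worlds ((subst_model repair ^^ k) M) = worlds M"
  and acc_repair_funpow: "acc ((subst_model repair ^^ k) M) = acc M"
  by (induction k) simp_all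

lemma card_reached_ge:
  assumes "preorder_model M" "w \<in> worlds M" "\<not> sat ((subst_model repair ^^ k) M) w settled"
  shows "k \<le> card (reached ((subst_model repair ^^ k) M) w)"
  using assms(2,3)
proof (induction k arbitrary: w)
  case (Suc k)
  let ?N = "(subst_model repair ^^ k) M"
  have N: "preorder_model ?N" "w \<in> worlds ?N"
    using assms(1) Suc.prems by (simp_all add: preorder_repair_funpow worlds_repair_funpow)
  obtain v where v: "v \<in> worlds ?N" "\<not> sat ?N v settled" "reached ?N v \<subset> reached ?N w"
    using repair_progress[OF N] Suc.prems(2) unfolding funpow.simps comp_def by blast
  have "k \<le> card (reached ?N v)"
    using Suc.IH[of v] v by (simp add: worlds_repair_funpow)
  \<comment> \<open>The strict growth comes from the step from \<open>v\<close> back to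
    \<open>w\<close>; the further repair at \<open>w\<close> loses nothing.\<close>
  moreover have "reached ?N v \<subset> reached (subst_model repair ?N) w"
    using v(3) reached_mono[OF N] by blast
  then have "card (reached ?N v) < card (reached (subst_model repair ?N) w)"
    by (rule psubset_card_mono[OF finite_subset[OF reached_subset finite_set]])
  ultimately show ?case by simp
qed simp

text \<open>The number of iterations exceeds by one the largest possible cardinality of
  \<open>reached\<close>.\<close>

definition unifier :: "nat \<Rightarrow> fm" where
  "unifier i = (subst repair ^^ Suc (card (set ws))) (Var i)"

lemma sat_unifier:
  "sat M w (subst unifier A) = sat ((subst_model repair ^^ Suc (card (set ws))) M) w A"
  unfolding unifier_def by (metis sat_subst_funpow subst_funpow)

lemma unifier_valid:
  assumes "preorder_model M" "w \<in> worlds M"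
  shows "\<exists>\<psi>\<in>set ws. sat M w (subst unifier \<psi>)"
proof -
  let ?k = "Suc (card (set ws))"
  let ?N = "(subst_model repair ^^ ?k) M"
  have "card (reached ?N w) \<le> card (set ws)"
    by (rule card_mono) (simp_all add: reached_subset)
  then have "sat ?N w settled"
    using card_reached_ge[OF assms, of ?k] by linarith
  moreover have "acc M w w" using assms unfolding preorder_model_def by blast
  ultimately show ?thesis
    using assms(2) unfolding sat_settled sat_unifier worlds_repair_funpow acc_repair_funpow by blast
qed

lemma unifier_settled:
  assumes M: "preorder_model M" "w \<in> worlds M" "sat M w settled"
  shows "sat M w (subst unifier A) = sat M w A"
proof -
  \<comment> \<open>\<open>A\<close> stays arbitrary because the induction hypothesis is also needed
    for \<open>settled\<close>.\<close>
  have "sat ((subst_model repair ^^ k) M) w A = sat M w A" for k A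
  proof (induction k arbitrary: A)
    case (Suc k)
    then show ?case
      using settled_preserved[of "(subst_model repair ^^ k) M" w A] M
      by (simp add: preorder_repair_funpow worlds_repair_funpow)
  qed simp
  then show ?thesis unfolding sat_unifier by blast
qed

end

section \<open>The criterion for inadmissibility\<close>

theorem theorem3p5:
  fixes n s :: nat and \<phi> :: "nat \<Rightarrow> fm" and I :: "nat set"
  assumes "n \<ge> 1"
    and "Theta n = \<phi> ` {1..s}"
    and "I \<subseteq> {1..s}"
  shows "\<not> admissible (BigDisj \<phi> I, Var 1) \<longleftrightarrow>
    (\<exists>W. W \<subseteq> \<phi> ` I \<and>
      (\<exists>\<psi>\<in>W. \<not> sat (MTheta n W) \<psi> (Var 1)) \<and>
      (\<forall>\<psi>\<in>W. sat (MTheta n W) \<psi> \<psi>) \<and>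
      (\<forall>D. D \<subseteq> W \<longrightarrow>
        (\<exists>\<psi>\<in>W. theta_dia n \<psi> = theta n \<psi> \<union> (\<Union>\<chi>\<in>D. theta_dia n \<chi>))))"
  (is "_ \<longleftrightarrow> (\<exists>W. ?P W)")
proof
  have I: "finite I" "\<phi> ` I \<subseteq> Theta n"
    using assms(2,3) finite_subset[OF _ finite_atLeastAtMost] by blast+
  {
    assume "\<not> admissible (BigDisj \<phi> I, Var 1)"
    then obtain \<sigma> where "S4 (subst \<sigma> (BigDisj \<phi> I))" "\<not> S4 (\<sigma> 1)"
      by (auto simp: admissible_def rejects_def)
    note W = rejecting_subst_realizes[OF I this assms(1)]
    show "\<exists>W. ?P W"
      by (intro exI[of _ "{\<psi> \<in> \<phi> ` I. \<not> S4 (Neg (subst \<sigma> \<psi>))}"] conjI W) blast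
  next
    assume "\<exists>W. ?P W"
    then obtain W where W: "W \<subseteq> \<phi> ` I" "\<exists>\<psi>\<in>W. \<not> sat (MTheta n W) \<psi> (Var 1)"
      "\<forall>\<psi>\<in>W. sat (MTheta n W) \<psi> \<psi>"
      "\<forall>D. D \<subseteq> W \<longrightarrow>
        (\<exists>\<psi>\<in>W. theta_dia n \<psi> = theta n \<psi> \<union> (\<Union>\<chi>\<in>D. theta_dia n \<chi>))"
      by (elim exE conjE) (rule that; assumption)
    obtain ws where set_ws: "set ws = W"
      using finite_list finite_subset[OF W(1)] I(1) by blast
    obtain d where d: "\<And>D. D \<subseteq> W \<Longrightarrow>
        d D \<in> W \<and> theta_dia n (d D) = theta n (d D) \<union> (\<Union>\<chi>\<in>D. theta_dia n \<chi>)"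
      using W(4) by metis
    interpret disjunct_choice n ws d
      using W(1) I(2) d set_ws by unfold_locales auto
    have "S4 (subst unifier (BigDisj \<phi> I))"
    proof (rule S4_complete)
      fix X assume "X \<in> worlds canonical"
      from unifier_valid[OF preorder_canonical this]
      show "sat canonical X (subst unifier (BigDisj \<phi> I))"
        using W(1) set_ws unfolding sat_subst sat_BigDisj[OF I(1)] by blast
    qed
    moreover have "\<not> S4 (unifier 1)"
    proof
      assume valid: "S4 (unifier 1)"
      obtain \<psi> where \<psi>: "\<psi> \<in> W" "\<not> sat (MTheta n W) \<psi> (Var 1)" using W(2) by blast
      \<comment> \<open>By (2) each world of this model satisfies a member of \<open>W\<close>,
        namely itself.\<close>
      have "sat (MTheta n W) \<psi> settled"
        using W(3) set_ws by (auto simp: sat_settled)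
      then have "sat (MTheta n W) \<psi> (subst unifier (Var 1)) = sat (MTheta n W) \<psi> (Var 1)"
        using unifier_settled[OF preorder_MTheta] \<psi>(1) MTheta_simps(1) by blast
      moreover have "sat (MTheta n W) \<psi> (subst unifier (Var 1))"
        using S4_sound[OF valid preorder_MTheta] \<psi>(1) by simp
      ultimately show False using \<psi>(2) by blast
    qed
    ultimately show "\<not> admissible (BigDisj \<phi> I, Var 1)"
      unfolding admissible_def rejects_def by auto
  }
qed

end
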